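(* Let $G$ be a $C_{4k}$-free bipartite graph. Then (1) $\operatorname{Supp}(G)$ is the set of vertices that belong to every maximum independent set of $G$; (2) $\operatorname{Core}(G)$ is the set of vertices that belong to no maximum independent set of $G$; (3) $\operatorname{Npart}(G)$ is the set of vertices that belong to some but not all maximum independent sets of $G$.
   Context: All graphs are finite, simple and undirected. A graph is a $C_{4k}$-free bipartite graph if it is bipartite and contains no cycle whose length is a multiple of $4$. For a graph $G$, $\operatorname{Null}(G)$ is the null space of its adjacency matrix, viewed as a subspace of $\mathbb{R}^{V(G)}$; $\operatorname{Supp}(G)$ is the set of vertices $v$ with $\vec{x}_v\neq0$ for some $\vec{x}\in\operatorname{Null}(G)$; $\operatorname{Core}(G)$ is the set of vertices adjacent to some vertex of $\operatorname{Supp}(G)$; $\operatorname{Npart}(G)=V(G)\setminus(\operatorname{Supp}(G)\cup\operatorname{Core}(G))$. *)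

theory Defs
  imports Complex_Main "Graph_Theory.Pair_Digraph"
begin

text \<open>
  A finite simple undirected graph is a \<^locale>\<open>pair_graph\<close>: finitely many vertices and a
  symmetric, loop-free arc relation on them, an edge between \<open>u\<close> and \<open>v\<close> being the pair of arcs
  \<open>(u, v)\<close> and \<open>(v, u)\<close>. The graph without vertices is allowed.
\<close>

definition bipartite :: "'a pair_pre_digraph \<Rightarrow> bool" where
  "bipartite G \<longleftrightarrow> (\<exists>X Y. pverts G = X \<union> Y \<and> X \<inter> Y = {} \<and> parcs G \<subseteq> X \<times> Y \<union> Y \<times> X)"

text \<open>
  In the symmetric digraph of a graph the closed walk \<open>u, v, u\<close> along one edge is a
  \<^const>\<open>pre_digraph.cycle\<close> of length 2. The bound 3 excludes it, so that exactly the cycles of the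
  undirected graph remain. The length of a cycle is the number of its arcs.
\<close>

definition graph_cycle :: "'a pair_pre_digraph \<Rightarrow> ('a \<times> 'a) awalk \<Rightarrow> bool" where
  "graph_cycle G p \<longleftrightarrow> pre_digraph.cycle (with_proj G) p \<and> 3 \<le> length p"

definition C4k_free_bipartite :: "'a pair_pre_digraph \<Rightarrow> bool" where
  "C4k_free_bipartite G \<longleftrightarrow> bipartite G \<and> \<not> (\<exists>p. graph_cycle G p \<and> 4 dvd length p)"

definition adjacency_matrix :: "'a pair_pre_digraph \<Rightarrow> 'a \<Rightarrow> 'a \<Rightarrow> real" where
  "adjacency_matrix G u v = (if (u, v) \<in> parcs G then 1 else 0)"

text \<open>
  A vector indexed by the vertices is represented by the function on the whole type that
  vanishes outside the vertex set.
\<close>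

definition Null :: "'a pair_pre_digraph \<Rightarrow> ('a \<Rightarrow> real) set" where
  "Null G = {x. (\<forall>v. v \<notin> pverts G \<longrightarrow> x v = 0) \<and>
     (\<forall>u\<in>pverts G. (\<Sum>v\<in>pverts G. adjacency_matrix G u v * x v) = 0)}"

definition Supp :: "'a pair_pre_digraph \<Rightarrow> 'a set" where
  "Supp G = {v \<in> pverts G. \<exists>x\<in>Null G. x v \<noteq> 0}"

definition Core :: "'a pair_pre_digraph \<Rightarrow> 'a set" where
  "Core G = {v \<in> pverts G. \<exists>u\<in>Supp G. (v, u) \<in> parcs G}"

definition Npart :: "'a pair_pre_digraph \<Rightarrow> 'a set" where
  "Npart G = pverts G - (Supp G \<union> Core G)"

definition independent_set :: "'a pair_pre_digraph \<Rightarrow> 'a set \<Rightarrow> bool" where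
  "independent_set G S \<longleftrightarrow> S \<subseteq> pverts G \<and> (\<forall>u\<in>S. \<forall>v\<in>S. (u, v) \<notin> parcs G)"

definition maximum_independent_set :: "'a pair_pre_digraph \<Rightarrow> 'a set \<Rightarrow> bool" where
  "maximum_independent_set G S \<longleftrightarrow>
     independent_set G S \<and> (\<forall>T. independent_set G T \<longrightarrow> card T \<le> card S)"

end

theory Submission
  imports Defs "Jordan_Normal_Form.Determinant" "HOL-Combinatorics.Cycles"
begin

text \<open>
  In the determinant expansion of a square block of the biadjacency matrix of a \<open>C\<^sub>4\<^sub>k\<close>-free
  bipartite graph all nonzero terms have the same sign: relative to a fixed perfect matching, a
  nonzero term of odd sign has a permutation cycle of even length \<open>k\<close>, which alternates with the
  matching along a graph cycle of length \<open>2k\<close>, a multiple of 4. So a block with a perfect matching is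
  nonsingular.

  Let \<open>I\<close> be a maximum independent set and \<open>X\<close>, \<open>Y\<close> the sides. Maximality gives Hall's condition for
  matching \<open>Y - I\<close> into \<open>I \<inter> X\<close>. The rows in \<open>I \<inter> X\<close> only see columns in \<open>Y - I\<close>, so a null vector
  vanishes on \<open>Y - I\<close>. If \<open>v \<in> X\<close> lies in all maximum independent sets, the matching can even avoid
  \<open>v\<close>; solving the matched system with the column of \<open>v\<close> on the right-hand side yields a null vector
  with value 1 at \<open>v\<close>. Finally, maximum independent sets form a lattice, so one of them has the least
  \<open>Y\<close>-part, and a vertex of \<open>X\<close> in no maximum independent set has a neighbour in this part.
\<close>

section \<open>Hall's marriage theorem\<close>

text \<open>Induction on \<open>card A\<close>. If a nonempty proper subset \<open>S\<close> is
  tight, it is matched within its neighbourhood and the rest outside it; if none is tight, any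
  single edge can be chosen and its ends deleted.\<close>

theorem hall_marriage:
  fixes N :: "'a \<Rightarrow> 'b set"
  assumes "finite A" and "\<And>a. a \<in> A \<Longrightarrow> finite (N a)"
    and "\<And>S. S \<subseteq> A \<Longrightarrow> card S \<le> card (\<Union>(N ` S))"
  shows "\<exists>m. inj_on m A \<and> (\<forall>a\<in>A. m a \<in> N a)"
  using assms
proof (induction "card A" arbitrary: A N rule: less_induct)
  case less
  note fin = less.prems(1) and finN = less.prems(2) and hall = less.prems(3)
  have finU: "finite (\<Union>(N ` S))" if "S \<subseteq> A" for S
    using that fin finN by (auto intro: finite_subset)
  show ?case
  proof (cases "A = {}")
    case True
    then show ?thesis by simp
  next
    case False
    show ?thesis
    proof (cases "\<exists>S. S \<subset> A \<and> S \<noteq> {} \<and> card (\<Union>(N ` S)) = card S")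
      case True
      then obtain S where S: "S \<subset> A" "S \<noteq> {}" "card (\<Union>(N ` S)) = card S"
        by blast
      let ?U = "\<Union>(N ` S)"
      have finS: "finite S" using S(1) fin by (auto intro: finite_subset)
      have "card S < card A" using S(1) fin by (simp add: psubset_card_mono)
      moreover have "card T \<le> card (\<Union>(N ` T))" if "T \<subseteq> S" for T
        using hall that S(1) by blast
      ultimately obtain m1 where m1: "inj_on m1 S" "\<forall>a\<in>S. m1 a \<in> N a"
        using less.hyps[of S N] finS finN S(1) by blast
      have "card (A - S) < card A"
        using S fin by (intro psubset_card_mono) auto
      \<comment> \<open>Tightness preserves Hall's condition: \<open>S\<close> and \<open>T\<close>
        together have at least \<open>card S + card T\<close> neighbours, and exactly
        \<open>card S\<close> of them are removed.\<close>
      moreover have "card T \<le> card (\<Union>((\<lambda>a. N a - ?U) ` T))" if T: "T \<subseteq> A - S" for T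
      proof -
        have finT: "finite T" using T fin by (auto intro: finite_subset)
        have eq: "\<Union>((\<lambda>a. N a - ?U) ` T) = \<Union>(N ` (S \<union> T)) - ?U" by auto
        have "card S + card T = card (S \<union> T)"
          using T finS finT by (subst card_Un_disjoint) auto
        also have "\<dots> \<le> card (\<Union>(N ` (S \<union> T)))"
          using T S(1) by (intro hall) auto
        finally have "card T \<le> card (\<Union>(N ` (S \<union> T))) - card ?U"
          using S(3) by simp
        also have "\<dots> = card (\<Union>(N ` (S \<union> T)) - ?U)"
          by (rule card_Diff_subset[symmetric]) (use finU S(1) in auto)
        finally show ?thesis by (simp only: eq)
      qed
      ultimately obtain m2 where m2: "inj_on m2 (A - S)" "\<forall>a\<in>A - S. m2 a \<in> N a - ?U"
        using less.hyps[of "A - S" "\<lambda>a. N a - ?U"] fin finN by blast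
      let ?m = "\<lambda>a. if a \<in> S then m1 a else m2 a"
      have "inj_on ?m A"
      proof (rule inj_onI)
        fix a b assume ab: "a \<in> A" "b \<in> A" "?m a = ?m b"
        show "a = b"
        proof (cases "a \<in> S"; cases "b \<in> S")
          assume "a \<in> S" "b \<in> S"
          then show ?thesis using ab m1(1) by (auto dest: inj_onD)
        next
          assume "a \<notin> S" "b \<notin> S"
          then show ?thesis using ab m2(1) by (auto dest: inj_onD)
        next
          assume "a \<in> S" "b \<notin> S"
          then have "m1 a \<in> ?U" "m2 b \<notin> ?U" using ab m1(2) m2(2) by blast+
          then show ?thesis using ab \<open>a \<in> S\<close> \<open>b \<notin> S\<close> by simp
        next
          assume "a \<notin> S" "b \<in> S"
          then have "m1 b \<in> ?U" "m2 a \<notin> ?U" using ab m1(2) m2(2) by blast+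
          then show ?thesis using ab \<open>a \<notin> S\<close> \<open>b \<in> S\<close> by simp
        qed
      qed
      moreover have "\<forall>a\<in>A. ?m a \<in> N a" using m1(2) m2(2) by auto
      ultimately show ?thesis by blast
    next
      case notight: False
      obtain a where a: "a \<in> A" using False by blast
      have "card {a} \<le> card (\<Union>(N ` {a}))" using a by (intro hall) auto
      then have "N a \<noteq> {}" by auto
      then obtain b where b: "b \<in> N a" by blast
      have "card (A - {a}) < card A"
        using a fin by (intro psubset_card_mono) auto
      \<comment> \<open>Without tight proper subsets, \<open>T\<close> has a neighbour to spare,
        which pays for the loss of \<open>b\<close>.\<close>
      moreover have "card T \<le> card (\<Union>((\<lambda>c. N c - {b}) ` T))" if T: "T \<subseteq> A - {a}" for T
      proof (cases "T = {}")
        case True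
        then show ?thesis by simp
      next
        case False
        have "T \<subset> A" "T \<subseteq> A" using T a by auto
        have "card (\<Union>(N ` T)) \<noteq> card T"
          using notight \<open>T \<subset> A\<close> False by blast
        then have "card T < card (\<Union>(N ` T))"
          using hall[OF \<open>T \<subseteq> A\<close>] by simp
        then have "card T \<le> card (\<Union>(N ` T)) - 1" by simp
        also have "\<dots> \<le> card (\<Union>(N ` T) - {b})"
          using finU[OF \<open>T \<subseteq> A\<close>] by (simp add: card_Diff_singleton_if)
        also have "\<Union>(N ` T) - {b} = \<Union>((\<lambda>c. N c - {b}) ` T)" by auto
        finally show ?thesis .
      qed
      ultimately obtain m where m: "inj_on m (A - {a})" "\<forall>c\<in>A - {a}. m c \<in> N c - {b}"
        using less.hyps[of "A - {a}" "\<lambda>c. N c - {b}"] fin finN by blast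
      have "inj_on (m(a := b)) A"
        using m by (auto simp: inj_on_def)
      moreover have "\<forall>c\<in>A. (m(a := b)) c \<in> N c" using m(2) b by auto
      ultimately show ?thesis by blast
    qed
  qed
qed

section \<open>Signs and cycles of permutations\<close>

lemma sign_cycle_of_list:
  assumes "distinct xs" and "xs \<noteq> []"
  shows "sign (cycle_of_list xs) = (- 1) ^ (length xs - 1)"
  using assms
proof (induction xs rule: cycle_of_list.induct)
  case (1 i j cs)
  then have "sign (transpose i j \<circ> cycle_of_list (j # cs)) = - sign (cycle_of_list (j # cs))"
    by (subst sign_compose)
      (auto simp: permutation_swap_id permutation_of_cycle sign_swap_id)
  then show ?case using 1 by (simp del: o_apply add: comp_def[symmetric])
qed auto

text \<open>The sign is multiplicative over the disjoint cycles, and a cycle of odd length has sign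
  1. The equation with \<open>rotate1\<close> says that \<open>p\<close> moves each entry to its
  cyclic successor.\<close>

lemma odd_permutation_even_cycle:
  assumes "p permutes S" and "finite S" and "sign p = - 1"
  shows "\<exists>xs. xs \<noteq> [] \<and> distinct xs \<and> set xs \<subseteq> S \<and> even (length xs) \<and> map p xs = rotate1 xs"
proof -
  have "cycle_decomp S p" using assms(1,2) by (rule cycle_decomposition)
  \<comment> \<open>The sign condition is a premise inside the claim because removing a cycle may
    change it; \<open>p permutes S\<close> confines \<open>p\<close> to the cycles handled so
    far.\<close>
  then have "permutation p \<and> p permutes S \<and> (sign p = - 1 \<longrightarrow> (\<exists>xs. xs \<noteq> [] \<and> distinct xs \<and>
      set xs \<subseteq> S \<and> even (length xs) \<and> map p xs = rotate1 xs))"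
  proof induction
    case empty
    then show ?case by (simp add: permutes_id flip: id_def)
  next
    case (comp I p cs)
    let ?c = "cycle_of_list cs"
    have p: "permutation p" "p permutes I" using comp.IH by auto
    have perm: "?c \<circ> p permutes set cs \<union> I"
      using permutes_subset[OF cycle_permutes[of cs]] permutes_subset[OF p(2)]
      by (intro permutes_compose) auto
    have "\<exists>xs. xs \<noteq> [] \<and> distinct xs \<and> set xs \<subseteq> set cs \<union> I \<and> even (length xs) \<and>
        map (?c \<circ> p) xs = rotate1 xs" if "sign (?c \<circ> p) = - 1"
    \<comment> \<open>Either the earlier cycles already have odd product, and the new disjoint cycle
      does not disturb the list found there, or the new cycle is itself odd and is the list
      sought.\<close>
    proof (cases "sign p = - 1")
      case True
      then obtain xs where xs: "xs \<noteq> []" "distinct xs" "set xs \<subseteq> I" "even (length xs)"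
        "map p xs = rotate1 xs"
        using comp.IH by blast
      have "?c (p x) = p x" if "x \<in> set xs" for x
        using that xs(3) permutes_in_image[OF p(2)] comp.hyps by (intro id_outside_supp) auto
      then have "map (?c \<circ> p) xs = map p xs" by simp
      then show ?thesis using xs by fastforce
    next
      case False
      then have "sign p = 1" using sign_cases by blast
      then have c: "sign ?c = - 1"
        using that by (simp add: sign_compose permutation_of_cycle p(1))
      then have "cs \<noteq> []" by auto
      moreover from this c have "even (length cs)"
        using sign_cycle_of_list[OF comp.hyps(2)] by (cases "even (length cs)") auto
      moreover have "p x = x" if "x \<in> set cs" for x
        using that permutes_not_in[OF p(2)] comp.hyps by blast
      then have "map (?c \<circ> p) cs = rotate1 cs"
        using cyclic_rotation[OF comp.hyps(2), of 1] by (simp cong: map_cong)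
      ultimately show ?thesis using comp.hyps(2) by blast
    qed
    then show ?case
      using perm permutation_compose[OF permutation_of_cycle p(1)] by blast
  qed
  then show ?thesis using assms(3) by blast
qed

section \<open>Graph cycles from alternating walks\<close>

text \<open>
  If \<open>p\<close> sends each element of \<open>xs\<close> to the next one, these are the arcs of the walk
  \<open>f x\<^sub>0, g x\<^sub>0, f x\<^sub>1, g x\<^sub>1, \<dots>\<close>.
\<close>

definition alternating_arcs :: "('i \<Rightarrow> 'a) \<Rightarrow> ('i \<Rightarrow> 'a) \<Rightarrow> ('i \<Rightarrow> 'i) \<Rightarrow> 'i list \<Rightarrow> ('a \<times> 'a) list" where
  "alternating_arcs f g p xs = concat (map (\<lambda>x. [(f x, g x), (g x, f (p x))]) xs)"

lemma length_alternating_arcs: "length (alternating_arcs f g p xs) = 2 * length xs"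
  unfolding alternating_arcs_def by (induction xs) auto

text \<open>The walk is left open, ending at \<open>f (p (last xs))\<close>, so that the induction
  can drop the head of \<open>xs\<close>; it closes up once \<open>p\<close> maps the last entry to
  the first.\<close>

lemma alternating_arcs_walk:
  assumes "xs \<noteq> []" and "successively (\<lambda>x y. y = p x) xs"
  shows "pcas (f (hd xs)) (alternating_arcs f g p xs) (f (p (last xs)))"
    and "pawalk_verts u (alternating_arcs f g p xs) =
      concat (map (\<lambda>x. [f x, g x]) xs) @ [f (p (last xs))]"
proof -
  have "pcas (f (hd xs)) (alternating_arcs f g p xs) (f (p (last xs))) \<and> (\<forall>u.
    pawalk_verts u (alternating_arcs f g p xs) =
      concat (map (\<lambda>x. [f x, g x]) xs) @ [f (p (last xs))])"
    using assms
  proof (induction xs)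
    case (Cons x xs)
    then show ?case
      by (cases xs) (auto simp: alternating_arcs_def)
  qed simp
  then show "pcas (f (hd xs)) (alternating_arcs f g p xs) (f (p (last xs)))"
    and "pawalk_verts u (alternating_arcs f g p xs) =
      concat (map (\<lambda>x. [f x, g x]) xs) @ [f (p (last xs))]"
    by auto
qed

text \<open>Injectivity and disjoint images keep the visited vertices distinct; two entries in
  \<open>xs\<close> exclude the walk back and forth along one edge.\<close>

lemma graph_cycle_alternating:
  assumes wf: "pair_wf_digraph G"
    and xs: "xs \<noteq> []" "distinct xs" "map p xs = rotate1 xs" "2 \<le> length xs"
    and inj: "inj_on f (set xs)" "inj_on g (set xs)" "f ` set xs \<inter> g ` set xs = {}"
    and arcs: "\<And>x. x \<in> set xs \<Longrightarrow> (f x, g x) \<in> parcs G"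
      "\<And>x. x \<in> set xs \<Longrightarrow> (g x, f (p x)) \<in> parcs G"
  shows "graph_cycle G (alternating_arcs f g p xs)"
proof -
  interpret pair_wf_digraph G by fact
  let ?w = "alternating_arcs f g p xs" and ?vs = "concat (map (\<lambda>x. [f x, g x]) xs)"
  have rot: "map p xs = tl xs @ [hd xs]" using xs(1,3) by (cases xs) auto
  have "last (map p xs) = hd xs" by (simp add: rot)
  then have last: "p (last xs) = hd xs" using xs(1) by (simp add: last_map)
  have succ: "successively (\<lambda>x y. y = p x) xs"
  proof (subst successively_conv_nth, intro allI impI)
    fix i assume i: "Suc i < length xs"
    have "p (xs ! i) = map p xs ! i" using i by simp
    also have "\<dots> = xs ! Suc i" unfolding rot using i by (cases xs) (auto simp: nth_append)
    finally show "xs ! Suc i = p (xs ! i)" by simp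
  qed
  have dist: "distinct ?vs"
    using xs(2) inj by (induction xs) (auto simp: inj_on_def)
  have verts: "pawalk_verts u ?w = ?vs @ [f (hd xs)]" for u
    using alternating_arcs_walk(2)[OF xs(1) succ] by (simp add: last)
  \<comment> \<open>A cycle requires distinctness only after the first vertex of the closed walk is
    dropped, and what remains is a rotation of \<open>?vs\<close>.\<close>
  have "tl (?vs @ [f (hd xs)]) = rotate1 ?vs"
    using xs(1) by (cases xs) auto
  then have "distinct (tl (pawalk_verts (f (hd xs)) ?w))"
    using dist by (simp add: verts)
  moreover have "pcas (f (hd xs)) ?w (f (hd xs))"
    using alternating_arcs_walk(1)[OF xs(1) succ] by (simp add: last)
  moreover have "f (hd xs) \<in> pverts G"
    using arcs(1) xs(1) in_arcsD1 hd_in_set by metis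
  moreover have "set ?w \<subseteq> parcs G"
    using arcs by (auto simp: alternating_arcs_def)
  ultimately show ?thesis
    using xs(4) length_alternating_arcs[of f g p xs]
    unfolding graph_cycle_def cycle_def awalk_def by auto
qed

section \<open>Nonsingularity of matched blocks\<close>

text \<open>The matching puts ones on the diagonal, so the identity contributes 1, and no other term
  of the Leibniz expansion is negative.\<close>

lemma det_matched_pos:
  assumes wf: "pair_wf_digraph G"
    and free: "\<And>w. graph_cycle G w \<Longrightarrow> \<not> 4 dvd length w"
    and inj: "inj_on f {0..<n}" "inj_on g {0..<n}" "f ` {0..<n} \<inter> g ` {0..<n} = {}"
    and matched: "\<And>i. i < n \<Longrightarrow> (f i, g i) \<in> parcs G \<and> (g i, f i) \<in> parcs G"
  shows "det (mat n n (\<lambda>(i, j). adjacency_matrix G (g i) (f j))) > 0" (is "det ?A > 0")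
proof -
  let ?t = "\<lambda>p. \<Prod>i = 0..<n. ?A $$ (i, p i)"
  have entry: "?A $$ (i, p i) = adjacency_matrix G (g i) (f (p i))"
    if "p permutes {0..<n}" "i < n" for p i
    using that permutes_in_image[of p "{0..<n}" i] by simp
  have nonneg: "0 \<le> signof p * ?t p" if p: "p permutes {0..<n}" for p
  proof (cases "sign p = - 1")
    case True
    then obtain xs where xs: "xs \<noteq> []" "distinct xs" "set xs \<subseteq> {0..<n}" "even (length xs)"
      "map p xs = rotate1 xs"
      using odd_permutation_even_cycle[OF p] by auto
    \<comment> \<open>Otherwise the matching arcs and the arcs from \<open>g i\<close> to
      \<open>f (p i)\<close> alternate along a graph cycle of length \<open>2 * length xs\<close>, a
      multiple of 4.\<close>
    have "\<exists>i<n. (g i, f (p i)) \<notin> parcs G"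
    proof (rule ccontr)
      assume "\<not> ?thesis"
      moreover have "length xs \<ge> 2" using xs(1,4) by (cases xs; cases "tl xs") auto
      ultimately have "graph_cycle G (alternating_arcs f g p xs)"
        using xs inj matched
        by (intro graph_cycle_alternating[OF wf]) (auto intro: inj_on_subset, blast+)
      then show False
        using free[of "alternating_arcs f g p xs"] xs(4) by (simp add: length_alternating_arcs)
    qed
    then have "?t p = 0"
      using entry[OF p] by (auto simp: adjacency_matrix_def)
    then show ?thesis by (simp only: mult_zero_right order_refl)
  next
    case False
    then have "sign p = 1" using sign_cases by blast
    then show ?thesis
      using entry[OF p] by (auto simp: adjacency_matrix_def intro!: prod_nonneg)
  qed
  have "0 < (\<Sum>p | p permutes {0..<n}. signof p * ?t p)"
  proof (rule sum_pos2)
    show "finite {p. p permutes {0..<n}}" by (simp add: finite_permutations)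
    show "id \<in> {p. p permutes {0..<n}}" by (simp add: permutes_id)
    show "0 < signof id * ?t id"
      using entry[OF permutes_id] matched by (auto simp: adjacency_matrix_def intro!: prod_pos)
  qed (use nonneg in auto)
  then show ?thesis by (simp add: det_def'[of _ n])
qed

text \<open>Restates invertibility for sums over vertices. Existence serves to construct a null
  vector, uniqueness to make one vanish.\<close>

lemma matched_system_solvable:
  fixes b :: "'a \<Rightarrow> real"
  assumes wf: "pair_wf_digraph G"
    and free: "\<And>w. graph_cycle G w \<Longrightarrow> \<not> 4 dvd length w"
    and fin: "finite J" and inj: "inj_on m J" and disj: "J \<inter> m ` J = {}"
    and matched: "\<And>j. j \<in> J \<Longrightarrow> (j, m j) \<in> parcs G \<and> (m j, j) \<in> parcs G"
  shows "\<exists>z. \<forall>i\<in>J. (\<Sum>j\<in>J. adjacency_matrix G (m i) j * z j) = b i" (is ?solvable)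
    and "\<lbrakk>\<And>i. i \<in> J \<Longrightarrow> (\<Sum>j\<in>J. adjacency_matrix G (m i) j * x j) = 0; j \<in> J\<rbrakk> \<Longrightarrow> x j = 0"
proof -
  define n where "n = card J"
  obtain f where f: "bij_betw f {0..<n} J"
    using ex_bij_betw_nat_finite[OF fin] unfolding n_def by blast
  define A where "A = mat n n (\<lambda>(i, j). adjacency_matrix G (m (f i)) (f j))"
  have fJ: "f i \<in> J" if "i < n" for i using that f by (auto dest: bij_betwE)
  have f_ex: "\<exists>i<n. f i = j" if "j \<in> J" for j
    using that f unfolding bij_betw_def by (metis atLeastLessThan_iff imageE)
  have "det A > 0"
    using det_matched_pos[OF wf free, of f n "m \<circ> f"] f inj disj matched fJ
    unfolding A_def bij_betw_def by (auto intro: comp_inj_on)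
  have A: "A \<in> carrier_mat n n" unfolding A_def by simp
  have mult: "(A *\<^sub>v vec n (z \<circ> f)) $ i = (\<Sum>j\<in>J. adjacency_matrix G (m (f i)) j * z j)"
    if "i < n" for z i
  proof -
    have "(A *\<^sub>v vec n (z \<circ> f)) $ i =
        (\<Sum>k = 0..<n. adjacency_matrix G (m (f i)) (f k) * z (f k))"
      using that by (simp add: A_def scalar_prod_def)
    also have "\<dots> = (\<Sum>j\<in>J. adjacency_matrix G (m (f i)) j * z j)"
      by (rule sum.reindex_bij_betw[OF f])
    finally show ?thesis .
  qed
  \<comment> \<open>The \<open>()\<close> fills the record extension of \<open>ring_mat\<close>;
    being a unit there unfolds to a two-sided inverse.\<close>
  from det_non_zero_imp_unit[OF A, of "()"] \<open>det A > 0\<close>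
  obtain B where B: "B \<in> carrier_mat n n" "A * B = 1\<^sub>m n" "B * A = 1\<^sub>m n"
    unfolding Units_def ring_mat_def by auto
  define c where "c = vec n (b \<circ> f)"
  \<comment> \<open>The solution vector is carried back to the vertices along the enumeration
    \<open>f\<close>; only its values on \<open>J\<close> matter.\<close>
  define z where "z j = (B *\<^sub>v c) $ (THE i. i < n \<and> f i = j)" for j
  have the: "(THE k. k < n \<and> f k = f i) = i" if "i < n" for i
    using that f by (intro the_equality) (auto simp: bij_betw_def inj_on_def)
  have "vec n (z \<circ> f) = B *\<^sub>v c"
    using B(1) by (intro eq_vecI) (auto simp: z_def the)
  then have "A *\<^sub>v vec n (z \<circ> f) = c"
    using A B assoc_mult_mat_vec[OF A B(1), of c] by (simp add: c_def)
  then have "(\<Sum>j\<in>J. adjacency_matrix G (m (f i)) j * z j) = b (f i)" if "i < n" for i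
    using mult[OF that, of z] that by (simp add: c_def)
  then show ?solvable using f_ex by metis
  show "x j = 0" if x: "\<And>i. i \<in> J \<Longrightarrow> (\<Sum>j\<in>J. adjacency_matrix G (m i) j * x j) = 0" and j: "j \<in> J"
  proof -
    have "A *\<^sub>v vec n (x \<circ> f) = 0\<^sub>v n"
      using A mult[of _ x] x fJ by (intro eq_vecI) auto
    moreover have zero: "B *\<^sub>v 0\<^sub>v n = 0\<^sub>v n"
      using B(1) by (intro eq_vecI) auto
    ultimately have "vec n (x \<circ> f) = 0\<^sub>v n"
      using assoc_mult_mat_vec[OF B(1) A, of "vec n (x \<circ> f)"] B zero by simp
    moreover obtain i where "i < n" "f i = j" using f_ex[OF j] by blast
    ultimately show ?thesis
      by (metis comp_apply index_vec index_zero_vec(1))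
  qed
qed

section \<open>Maximum independent sets and null vectors\<close>

locale bipartite_graph = pair_graph G for G :: "'a pair_pre_digraph" +
  fixes X Y :: "'a set"
  assumes verts: "pverts G = X \<union> Y" and disjoint: "X \<inter> Y = {}"
    and arcs: "parcs G \<subseteq> X \<times> Y \<union> Y \<times> X"
begin

text \<open>Lets each one-sided result below be used for both sides.\<close>

lemma swap: "bipartite_graph G Y X"
  by unfold_locales (use verts disjoint arcs in auto)

lemma arc_commute: "(u, v) \<in> parcs G \<longleftrightarrow> (v, u) \<in> parcs G"
  using pair_sym_arcs by (auto simp: symmetric_def sym_def)

lemma finite_independent: "independent_set G S \<Longrightarrow> finite S"
  using pair_finite_verts by (auto simp: independent_set_def intro: finite_subset)

text \<open>An exchange argument: if \<open>S\<close> violates Hall's condition, trading its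
  neighbours and \<open>F\<close> for \<open>S\<close> gives an independent set too large, or a
  maximum one missing \<open>F\<close>. The uses are \<open>F = {}\<close> and
  \<open>F = {v}\<close>.\<close>

lemma maximum_independent_set_matching:
  assumes I: "maximum_independent_set G I"
    and F: "F \<subseteq> X" "card F \<le> 1" "finite F"
      "\<And>J. maximum_independent_set G J \<Longrightarrow> F \<subseteq> J"
  shows "\<exists>m. inj_on m (Y - I) \<and> (\<forall>y\<in>Y - I. (y, m y) \<in> parcs G \<and> m y \<in> I \<inter> X - F)"
proof -
  have indI: "independent_set G I" using I by (simp add: maximum_independent_set_def)
  define N where "N y = {u. (y, u) \<in> parcs G \<and> u \<in> I \<inter> X - F}" for y
  have finI: "finite I" by (rule finite_independent[OF indI])
  have "\<exists>m. inj_on m (Y - I) \<and> (\<forall>y\<in>Y - I. m y \<in> N y)"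
  proof (rule hall_marriage)
    show "finite (Y - I)" using pair_finite_verts verts by simp
    show "finite (N y)" for y
      using finI by (rule finite_subset[rotated]) (auto simp: N_def)
    show "card S \<le> card (\<Union>(N ` S))" if S: "S \<subseteq> Y - I" for S
    proof (rule ccontr)
      let ?D = "\<Union>(N ` S)"
      let ?T = "(I - ?D - F) \<union> S"
      assume less: "\<not> ?thesis"
      have finS: "finite S" using S pair_finite_verts verts by (auto intro: finite_subset)
      have "?D \<subseteq> I" "F \<subseteq> I" "?D \<inter> F = {}" using F(4)[OF I] by (auto simp: N_def)
      moreover from this have "finite ?D" using finI by (blast intro: finite_subset)
      ultimately have "card (?D \<union> F) = card ?D + card F" "card (?D \<union> F) \<le> card I"
        using finI F(3) by (auto intro: card_Un_disjoint card_mono)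
      moreover have "I - ?D - F = I - (?D \<union> F)" by blast
      moreover have "card (I - (?D \<union> F)) = card I - card (?D \<union> F)"
        using \<open>?D \<subseteq> I\<close> \<open>F \<subseteq> I\<close> \<open>finite ?D\<close> F(3)
        by (intro card_Diff_subset) auto
      moreover have "card ?T = card (I - ?D - F) + card S"
        using S finI finS by (intro card_Un_disjoint) auto
      \<comment> \<open>The violation gives \<open>card S\<close> at least
        \<open>card ?D + 1\<close>, while the exchange removes \<open>card ?D + card F\<close>
        vertices.\<close>
      ultimately have cardT: "card ?T \<ge> card I + 1 - card F" using less by simp
      have IS: "(u, s) \<notin> parcs G" if "u \<in> I - ?D - F" "s \<in> S" for u s
      proof
        assume "(u, s) \<in> parcs G"
        then have "u \<in> X" "(s, u) \<in> parcs G"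
          using arcs disjoint S that(2) arc_commute by blast+
        then have "u \<in> N s" using that(1) by (simp add: N_def)
        then show False using that by blast
      qed
      have SS: "(s, t) \<notin> parcs G" if "s \<in> S" "t \<in> S" for s t
        using that S arcs disjoint by blast
      have II: "(u, w) \<notin> parcs G" if "u \<in> I - ?D - F" "w \<in> I - ?D - F" for u w
        using that indI by (simp add: independent_set_def)
      have "I \<subseteq> pverts G" using indI by (simp add: independent_set_def)
      then have "?T \<subseteq> pverts G" using S verts by blast
      moreover have "(u, w) \<notin> parcs G" if "u \<in> ?T" "w \<in> ?T" for u w
        using that IS[of u w] IS[of w u] SS[of u w] II[of u w] arc_commute[of u w] by (elim UnE) simp_all
      ultimately have indT: "independent_set G ?T"
        unfolding independent_set_def by simp
      then have "card ?T \<le> card I" using I by (simp add: maximum_independent_set_def)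
      \<comment> \<open>For empty \<open>F\<close> the new set would beat \<open>I\<close>; so
        \<open>F\<close> is a singleton and the new set is maximum, yet avoids
        \<open>F\<close>.\<close>
      then have "card F = 1" using cardT F(2) by simp
      then have "maximum_independent_set G ?T"
        using I indT cardT unfolding maximum_independent_set_def by (auto intro: order_trans)
      then have "F \<subseteq> ?T" by (rule F(4))
      moreover have "F \<inter> S = {}" using F(1) S disjoint by blast
      ultimately have "F = {}" by blast
      then show False using \<open>card F = 1\<close> by simp
    qed
  qed
  then show ?thesis unfolding N_def by blast
qed

lemma Supp_subset_maximum:
  assumes free: "\<And>w. graph_cycle G w \<Longrightarrow> \<not> 4 dvd length w"
    and v: "v \<in> Y" "v \<in> Supp G" and I: "maximum_independent_set G I"
  shows "v \<in> I"
proof (rule ccontr)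
  assume "v \<notin> I"
  obtain m where m: "inj_on m (Y - I)"
    "\<And>y. y \<in> Y - I \<Longrightarrow> (y, m y) \<in> parcs G" "\<And>y. y \<in> Y - I \<Longrightarrow> m y \<in> I \<inter> X"
    using maximum_independent_set_matching[OF I, of "{}"] by auto
  obtain x where x: "x \<in> Null G" "x v \<noteq> 0" using v(2) by (auto simp: Supp_def)
  have "x v = 0"
  proof (rule matched_system_solvable(2)[OF pair_wf_digraph_axioms free _ m(1)])
    show "finite (Y - I)" using pair_finite_verts verts by simp
    show "(Y - I) \<inter> m ` (Y - I) = {}" using m(3) disjoint by auto
    show "(j, m j) \<in> parcs G \<and> (m j, j) \<in> parcs G" if "j \<in> Y - I" for j
      using m(2)[OF that] arc_commute by blast
    show "v \<in> Y - I" using v \<open>v \<notin> I\<close> by simp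
    fix i assume i: "i \<in> Y - I"
    \<comment> \<open>Neighbours of \<open>m i\<close> lie in \<open>Y\<close> by bipartiteness and
      outside \<open>I\<close> by independence, so this row of the null equations restricts to the
      square system.\<close>
    have "adjacency_matrix G (m i) u = 0" if "u \<in> pverts G - (Y - I)" for u
      using that m(3)[OF i] I arcs disjoint verts
      unfolding adjacency_matrix_def maximum_independent_set_def independent_set_def by auto
    then have "(\<Sum>j\<in>Y - I. adjacency_matrix G (m i) j * x j) =
        (\<Sum>j\<in>pverts G. adjacency_matrix G (m i) j * x j)"
      using pair_finite_verts verts by (intro sum.mono_neutral_left) auto
    also have "\<dots> = 0" using x(1) m(3)[OF i] verts by (auto simp: Null_def)
    finally show "(\<Sum>j\<in>Y - I. adjacency_matrix G (m i) j * x j) = 0" .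
  qed
  then show False using x(2) by simp
qed

lemma in_all_maximum_imp_Supp:
  assumes free: "\<And>w. graph_cycle G w \<Longrightarrow> \<not> 4 dvd length w"
    and v: "v \<in> X" "\<And>J. maximum_independent_set G J \<Longrightarrow> v \<in> J"
    and I: "maximum_independent_set G I"
  shows "v \<in> Supp G"
proof -
  obtain m where m: "inj_on m (Y - I)"
    "\<And>y. y \<in> Y - I \<Longrightarrow> (y, m y) \<in> parcs G" "\<And>y. y \<in> Y - I \<Longrightarrow> m y \<in> I \<inter> X - {v}"
    using maximum_independent_set_matching[OF I, of "{v}"] v by auto
  \<comment> \<open>The unknowns now sit at the matched vertices \<open>J\<close> in
    \<open>X\<close> and the equations at \<open>Y - I\<close>, so the system is indexed by
    \<open>J\<close> with the inverse matching \<open>r\<close>.\<close>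
  define J where "J = m ` (Y - I)"
  define r where "r = inv_into (Y - I) m"
  have r: "r (m y) = y" if "y \<in> Y - I" for y
    using that m(1) by (simp add: r_def)
  have JI: "J \<subseteq> I \<inter> X - {v}" using m(3) by (auto simp: J_def)
  have finJ: "finite J" using pair_finite_verts verts by (simp add: J_def)
  have "\<exists>z. \<forall>i\<in>J. (\<Sum>j\<in>J. adjacency_matrix G (r i) j * z j) = - adjacency_matrix G (r i) v"
  proof (rule matched_system_solvable(1)[OF pair_wf_digraph_axioms free finJ])
    show "inj_on r J" unfolding r_def J_def by (rule inj_on_inv_into) simp
    show "J \<inter> r ` J = {}" using JI disjoint by (auto simp: J_def r)
    show "(j, r j) \<in> parcs G \<and> (r j, j) \<in> parcs G" if "j \<in> J" for j
      using that m(2) arc_commute by (auto simp: J_def r)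
  qed
  then obtain z where z: "\<And>y. y \<in> Y - I \<Longrightarrow>
      (\<Sum>j\<in>J. adjacency_matrix G y j * z j) = - adjacency_matrix G y v"
    by (auto simp: J_def r)
  \<comment> \<open>The value 1 at \<open>v\<close> cancels the right-hand side
    \<open>- adjacency_matrix G y v\<close>.\<close>
  define x where "x u = (if u = v then 1 else if u \<in> J then z u else 0)" for u
  have vI: "v \<in> I \<inter> X" using v I by blast
  have supp: "x u = 0" if "u \<notin> I \<inter> X" for u
    using that JI vI by (auto simp: x_def)
  have IV: "I \<subseteq> pverts G" using I by (simp add: maximum_independent_set_def independent_set_def)
  have "(\<Sum>u\<in>pverts G. adjacency_matrix G w u * x u) = 0" if w: "w \<in> pverts G" for w
  proof (cases "w \<in> Y - I")
    case True
    have "(\<Sum>u\<in>pverts G. adjacency_matrix G w u * x u) =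
        (\<Sum>u\<in>insert v J. adjacency_matrix G w u * x u)"
      using pair_finite_verts JI vI IV by (intro sum.mono_neutral_right) (auto simp: x_def)
    also have "\<dots> = adjacency_matrix G w v + (\<Sum>u\<in>J. adjacency_matrix G w u * x u)"
      using finJ JI by (subst sum.insert) (auto simp: x_def)
    also have "(\<Sum>u\<in>J. adjacency_matrix G w u * x u) = (\<Sum>u\<in>J. adjacency_matrix G w u * z u)"
      using JI by (intro sum.cong) (auto simp: x_def)
    finally show ?thesis using z[OF True] by simp
  next
    case False
    \<comment> \<open>Here \<open>w\<close> lies in \<open>X\<close> or in \<open>I\<close>, so it
      has no neighbour in the support of \<open>x\<close>.\<close>
    then have "(w, u) \<notin> parcs G" if "u \<in> I \<inter> X" for u
      using that w I arcs disjoint verts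
      unfolding maximum_independent_set_def independent_set_def by blast
    then show ?thesis
      using supp by (intro sum.neutral) (auto simp: adjacency_matrix_def)
  qed
  then have "x \<in> Null G" using supp IV by (auto simp: Null_def)
  moreover have "x v \<noteq> 0" by (simp add: x_def)
  ultimately show ?thesis using vI verts unfolding Supp_def by blast
qed

text \<open>This set and its mirror image \<open>?L\<close> have union \<open>I \<union> J\<close>
  and intersection \<open>I \<inter> J\<close>, so their sizes add up to twice the maximum; neither
  can exceed it.\<close>

lemma maximum_independent_set_meet:
  assumes I: "maximum_independent_set G I" and J: "maximum_independent_set G J"
  shows "maximum_independent_set G ((I \<union> J) \<inter> X \<union> I \<inter> J \<inter> Y)" (is "maximum_independent_set G ?K")
proof -
  let ?L = "(I \<union> J) \<inter> Y \<union> I \<inter> J \<inter> X"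
  have ind: "independent_set G I" "independent_set G J"
    using I J by (auto simp: maximum_independent_set_def)
  have K: "independent_set G ?K" and L: "independent_set G ?L"
    using ind arcs disjoint unfolding independent_set_def by blast+
  have "?K \<union> ?L = I \<union> J" "?K \<inter> ?L = I \<inter> J"
    using ind disjoint verts unfolding independent_set_def by blast+
  then have "card ?K + card ?L = card I + card J"
    using card_Un_Int[of ?K ?L] card_Un_Int[of I J] finite_independent ind K L by metis
  moreover have "card ?L \<le> card J" "card I = card J"
    using I J L ind unfolding maximum_independent_set_def by (auto intro: antisym)
  ultimately have "card I \<le> card ?K" by simp
  then show ?thesis
    using I K unfolding maximum_independent_set_def by (auto intro: order_trans)
qed

lemma in_no_maximum_imp_neighbour:
  assumes v: "v \<in> X" "\<And>J. maximum_independent_set G J \<Longrightarrow> v \<notin> J"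
    and ex: "maximum_independent_set G I0"
  shows "\<exists>u\<in>Y. (v, u) \<in> parcs G \<and> (\<forall>J. maximum_independent_set G J \<longrightarrow> u \<in> J)"
proof -
  obtain I where I: "maximum_independent_set G I"
    and least: "\<And>J. maximum_independent_set G J \<Longrightarrow> card (I \<inter> Y) \<le> card (J \<inter> Y)"
    using ex_has_least_nat[of "maximum_independent_set G" I0 "\<lambda>J. card (J \<inter> Y)"] ex by blast
  have ind: "independent_set G I" using I by (simp add: maximum_independent_set_def)
  have finI: "finite I" by (rule finite_independent[OF ind])
  \<comment> \<open>Meeting \<open>I\<close> with \<open>J\<close> cannot shrink the least
    \<open>Y\<close>-part.\<close>
  have "I \<inter> Y \<subseteq> J" if J: "maximum_independent_set G J" for J
  proof -
    have "((I \<union> J) \<inter> X \<union> I \<inter> J \<inter> Y) \<inter> Y = I \<inter> J \<inter> Y" using disjoint by blast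
    then have "card (I \<inter> Y) \<le> card (I \<inter> J \<inter> Y)"
      using least[OF maximum_independent_set_meet[OF I J]] by simp
    then have "I \<inter> J \<inter> Y = I \<inter> Y" using finI by (intro card_seteq) auto
    then show ?thesis by blast
  qed
  \<comment> \<open>Without such a neighbour, \<open>v\<close> could be added to
    \<open>I\<close>.\<close>
  moreover have "\<exists>u\<in>I. (v, u) \<in> parcs G"
  proof (rule ccontr)
    assume "\<not> ?thesis"
    then have "independent_set G (insert v I)"
      using ind v(1) verts arc_commute no_loops' unfolding independent_set_def by blast
    then have "card (insert v I) \<le> card I" using I by (simp add: maximum_independent_set_def)
    then show False using v(2)[OF I] finI by simp
  qed
  ultimately show ?thesis using arcs disjoint v(1) by blast
qed

end

lemma maximum_independent_set_exists:
  assumes "finite (pverts G)"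
  shows "\<exists>I. maximum_independent_set G I"
proof -
  have "card S \<le> card (pverts G)" if "independent_set G S" for S
    using that assms by (simp add: independent_set_def card_mono)
  moreover have "independent_set G {}" by (simp add: independent_set_def)
  ultimately show ?thesis
    \<comment> \<open>\<open>Suc\<close> turns the bound on cardinalities into a strict one.\<close>
    using ex_has_greatest_nat[of "independent_set G" "{}" card "Suc (card (pverts G))"]
    unfolding maximum_independent_set_def by (metis le_imp_less_Suc)
qed

section \<open>The three vertex classes\<close>

theorem theorem6p5:
  fixes G :: "'a pair_pre_digraph"
  assumes "pair_graph G"
    and "C4k_free_bipartite G"
  shows "Supp G = {v \<in> pverts G. \<forall>S. maximum_independent_set G S \<longrightarrow> v \<in> S} \<and>
    Core G = {v \<in> pverts G. \<forall>S. maximum_independent_set G S \<longrightarrow> v \<notin> S} \<and>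
    Npart G = {v \<in> pverts G. (\<exists>S. maximum_independent_set G S \<and> v \<in> S) \<and>
                             (\<exists>S. maximum_independent_set G S \<and> v \<notin> S)}"
proof -
  interpret pair_graph G by fact
  have free: "\<not> 4 dvd length w" if "graph_cycle G w" for w
    using that assms(2) by (auto simp: C4k_free_bipartite_def)
  obtain X Y where "pverts G = X \<union> Y" "X \<inter> Y = {}" "parcs G \<subseteq> X \<times> Y \<union> Y \<times> X"
    using assms(2) by (auto simp: C4k_free_bipartite_def bipartite_def)
  then interpret XY: bipartite_graph G X Y by unfold_locales
  interpret YX: bipartite_graph G Y X by (rule XY.swap)
  obtain I where I: "maximum_independent_set G I"
    using maximum_independent_set_exists[OF pair_finite_verts] by blast
  have Supp: "Supp G = {v \<in> pverts G. \<forall>S. maximum_independent_set G S \<longrightarrow> v \<in> S}"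
  proof (intro equalityI subsetI)
    fix v assume v: "v \<in> Supp G"
    then have "v \<in> pverts G" by (simp add: Supp_def)
    moreover have "v \<in> S" if "maximum_independent_set G S" for S
      using \<open>v \<in> pverts G\<close> XY.Supp_subset_maximum[OF free _ v that]
        YX.Supp_subset_maximum[OF free _ v that] XY.verts by blast
    ultimately show "v \<in> {v \<in> pverts G. \<forall>S. maximum_independent_set G S \<longrightarrow> v \<in> S}" by blast
  next
    fix v assume "v \<in> {v \<in> pverts G. \<forall>S. maximum_independent_set G S \<longrightarrow> v \<in> S}"
    then show "v \<in> Supp G"
      using XY.in_all_maximum_imp_Supp[OF free _ _ I] YX.in_all_maximum_imp_Supp[OF free _ _ I]
        XY.verts by blast
  qed
  have Core: "Core G = {v \<in> pverts G. \<forall>S. maximum_independent_set G S \<longrightarrow> v \<notin> S}"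
  proof (intro equalityI subsetI)
    fix v assume "v \<in> Core G"
    then obtain u where "v \<in> pverts G" "u \<in> Supp G" "(v, u) \<in> parcs G"
      by (auto simp: Core_def)
    then show "v \<in> {v \<in> pverts G. \<forall>S. maximum_independent_set G S \<longrightarrow> v \<notin> S}"
      unfolding Supp maximum_independent_set_def independent_set_def by blast
  next
    fix v assume v: "v \<in> {v \<in> pverts G. \<forall>S. maximum_independent_set G S \<longrightarrow> v \<notin> S}"
    \<comment> \<open>By the description of \<open>Supp G\<close> just proved, this \<open>u\<close>
      lies in the support.\<close>
    then have "\<exists>u. (v, u) \<in> parcs G \<and> (\<forall>J. maximum_independent_set G J \<longrightarrow> u \<in> J)"
      using XY.in_no_maximum_imp_neighbour[OF _ _ I, of v]
        YX.in_no_maximum_imp_neighbour[OF _ _ I, of v] XY.verts by blast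
    then show "v \<in> Core G"
      using v in_arcsD2 unfolding Core_def Supp by blast
  qed
  show ?thesis
    using Supp Core unfolding Npart_def by blast
qed

end
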